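(* Let $M$ be a Banach manifold, let $G$ be a compact Lie group acting smoothly on $M$, and let $X$ be a $G$-equivariant vector field on $M$ (not assumed Lipschitz or even continuous). Let $m$ be a relative equilibrium of $X$, and let $G_m$ be its isotropy subgroup. Fix a Slice Theorem decomposition $G\times_{G_m}S$ of a neighborhood of $G\cdot m$, where $S$ is an open ball, centered at the origin, in a Banach space whose norm is (without loss of generality) $G_m$-invariant. Let $P\colon M\to\mathbb{R}$ be a continuous $G$-invariant function whose restriction to $S$ is a function of the norm which has a strict minimum, equal to zero, at the origin. Suppose there exists a $G$-invariant function $f\colon M\to\mathbb{R}$ with $f(m)=0$ such that (1) $m$ is a critical point of $f$; (2) $P(u)\le f(u)$ for all $u$ near $m$; and (3) for every $\epsilon>0$ there exists a neighborhood $V$ of $m$ such that $f(u(t))<\epsilon$ for any integral curve $u(t)$ of $X$ with initial condition $u(0)\in V$, for all $t\ge 0$ for which $u(t)$ is defined. Then for every $\epsilon>0$ there exists a neighborhood $U$ of the orbit $G\cdot m$ such that $P(u(t))<\epsilon$ for any integral curve $u(t)$ of $X$ with $u(0)\in U$, for all $t\ge0$ for which $u(t)$ is defined.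
   Context: Existence and uniqueness of integral curves of $X$ are not assumed; an integral curve is a differentiable curve $u$, defined on an interval containing $0$, with $\dot u(t)=X(u(t))$. A point $m$ is a relative equilibrium of $X$ if there is $\xi$ in the Lie algebra of $G$ such that $t\mapsto(\exp t\xi)\cdot m$ is an integral curve of $X$. That $m$ is a critical point of $f$ means $f$ is differentiable at $m$ with $Df(m)=0$. A Slice Theorem decomposition at $m$ is a $G$-equivariant diffeomorphism from the associated bundle $G\times_{G_m}S$ onto a $G$-invariant open neighborhood of the orbit $G\cdot m$, where $G_m$ acts linearly on the Banach space containing the open ball $S$, the ball $S$ is $G_m$-invariant, and the class $[e,0]$ is sent to $m$. The slice $S$ is identified with the image of $\{[e,s]:s\in S\}$ in $M$, so the origin of $S$ corresponds to $m$.
   Formalization: The Banach manifold M is assumed Hausdorff and regular as a topological space (automatic if it is paracompact or metrizable); in a non-regular Hausdorff Banach manifold, integral curves can leave the slice neighborhood without crossing its spheres and the claim fails. *)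

theory Defs
  imports "HOL-Analysis.Analysis" "HOL-Algebra.Group_Action"
begin

text \<open>
  \<open>D vs x\<close> is the \<open>n\<close>-th Frechet derivative of \<open>f\<close> at \<open>x\<close>, \<open>n = length vs\<close>, applied to the
  vectors \<open>vs\<close>. The list encoding replaces the iterated operator spaces, whose type depends on
  \<open>n\<close>. The last clause is Frechet differentiability of the \<open>n\<close>-th derivative with respect to the
  operator norm of \<open>n\<close>-linear maps.
\<close>

definition smooth_on :: "'a::real_normed_vector set \<Rightarrow> ('a \<Rightarrow> 'b::real_normed_vector) \<Rightarrow> bool"
  where "smooth_on S f \<longleftrightarrow> (\<exists>D :: 'a list \<Rightarrow> 'a \<Rightarrow> 'b. \<forall>x\<in>S.
     D [] x = f x \<and>
     (\<forall>us vs. linear (\<lambda>v. D (us @ v # vs) x)) \<and>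
     (\<forall>n. \<exists>K. \<forall>vs. length vs = n \<longrightarrow> norm (D vs x) \<le> K * prod_list (map norm vs)) \<and>
     (\<forall>n. \<forall>e>0. \<exists>d>0. \<forall>y\<in>S. norm (y - x) < d \<longrightarrow> (\<forall>vs. length vs = n \<longrightarrow>
        norm (D vs y - D vs x - D ((y - x) # vs) x) \<le> e * norm (y - x) * prod_list (map norm vs))))"

type_synonym ('p, 'e) chart = "'p set \<times> ('p \<Rightarrow> 'e)"

record ('p, 'e) manifold =
  mtop :: "'p topology"
  charts :: "('p, 'e) chart set"

abbreviation mspace_of :: "('p, 'e) manifold \<Rightarrow> 'p set"
  where "mspace_of M \<equiv> topspace (mtop M)"

definition is_chart :: "'p topology \<Rightarrow> ('p, 'e::banach) chart \<Rightarrow> bool"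
  where "is_chart T c \<longleftrightarrow> openin T (fst c) \<and> open (snd c ` fst c) \<and>
     homeomorphic_map (subtopology T (fst c)) (top_of_set (snd c ` fst c)) (snd c)"

definition charts_at :: "('p, 'e) manifold \<Rightarrow> 'p \<Rightarrow> ('p, 'e) chart set"
  where "charts_at M x = {c \<in> charts M. x \<in> fst c}"

definition local_rep :: "('p, 'e) chart \<Rightarrow> ('q, 'f) chart \<Rightarrow> ('p \<Rightarrow> 'q) \<Rightarrow> 'e \<Rightarrow> 'f"
  where "local_rep c d F = snd d \<circ> F \<circ> inv_into (fst c) (snd c)"

text \<open>
  Regularity does not follow from the Hausdorff property for infinite-dimensional Banach
  manifolds; it is implied by the usual paracompactness or metrizability requirements.
\<close>

definition banach_manifold :: "('p, 'e::banach) manifold \<Rightarrow> bool"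
  where "banach_manifold M \<longleftrightarrow>
     Hausdorff_space (mtop M) \<and> regular_space (mtop M) \<and>
     (\<forall>c\<in>charts M. is_chart (mtop M) c) \<and>
     (\<Union>c\<in>charts M. fst c) = mspace_of M \<and>
     (\<forall>c\<in>charts M. \<forall>d\<in>charts M.
        smooth_on (snd c ` (fst c \<inter> fst d)) (local_rep c d id))"

definition smooth_map ::
    "('p, 'e::banach) manifold \<Rightarrow> ('q, 'f::banach) manifold \<Rightarrow> ('p \<Rightarrow> 'q) \<Rightarrow> bool"
  where "smooth_map M N F \<longleftrightarrow> continuous_map (mtop M) (mtop N) F \<and>
     (\<forall>c\<in>charts M. \<forall>d\<in>charts N.
        smooth_on (snd c ` (fst c \<inter> F -` fst d)) (local_rep c d F))"

definition diffeomorphism ::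
    "('p, 'e::banach) manifold \<Rightarrow> ('q, 'f::banach) manifold \<Rightarrow> ('p \<Rightarrow> 'q) \<Rightarrow> bool"
  where "diffeomorphism M N F \<longleftrightarrow> bij_betw F (mspace_of M) (mspace_of N) \<and>
     smooth_map M N F \<and> smooth_map N M (inv_into (mspace_of M) F)"

definition model_manifold :: "('e::banach, 'e) manifold"
  where "model_manifold = \<lparr>mtop = euclidean, charts = {(UNIV, id)}\<rparr>"

definition open_submanifold :: "('p, 'e) manifold \<Rightarrow> 'p set \<Rightarrow> ('p, 'e) manifold"
  where "open_submanifold M W =
     \<lparr>mtop = subtopology (mtop M) W, charts = (\<lambda>(U, \<phi>). (U \<inter> W, \<phi>)) ` charts M\<rparr>"

definition prod_manifold ::
    "('p, 'e) manifold \<Rightarrow> ('q, 'f) manifold \<Rightarrow> ('p \<times> 'q, 'e \<times> 'f) manifold"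
  where "prod_manifold M N =
     \<lparr>mtop = prod_topology (mtop M) (mtop N),
      charts = (\<lambda>((U, \<phi>), (V, \<psi>)). (U \<times> V, map_prod \<phi> \<psi>)) ` (charts M \<times> charts N)\<rparr>"

text \<open>
  A tangent vector at \<open>x\<close> is an equivalence class of pairs (chart at \<open>x\<close>, vector in the model
  space). A class contains exactly one pair for every chart at \<open>x\<close>, so it is encoded as a function
  from charts to the model space, which is set to \<open>0\<close> off the charts at \<open>x\<close>.
\<close>

type_synonym ('p, 'e) tangent = "('p, 'e) chart \<Rightarrow> 'e"

definition tangent_space :: "('p, 'e::banach) manifold \<Rightarrow> 'p \<Rightarrow> ('p, 'e) tangent set"
  where "tangent_space M x = {v.
     (\<forall>c\<in>charts_at M x. \<forall>d\<in>charts_at M x.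
        v d = frechet_derivative (local_rep c d id) (at (snd c x)) (v c)) \<and>
     (\<forall>c. c \<notin> charts_at M x \<longrightarrow> v c = 0)}"

text \<open>The value does not depend on the chart chosen at \<open>x\<close>.\<close>

definition tangent_map :: "('p, 'e::banach) manifold \<Rightarrow> ('q, 'f::banach) manifold \<Rightarrow>
    ('p \<Rightarrow> 'q) \<Rightarrow> 'p \<Rightarrow> ('p, 'e) tangent \<Rightarrow> ('q, 'f) tangent"
  where "tangent_map M N F x v = (\<lambda>d.
     if d \<in> charts_at N (F x)
     then let c = (SOME c. c \<in> charts_at M x)
          in frechet_derivative (local_rep c d F) (at (snd c x)) (v c)
     else 0)"

definition vector_field :: "('p, 'e::banach) manifold \<Rightarrow> ('p \<Rightarrow> ('p, 'e) tangent) \<Rightarrow> bool"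
  where "vector_field M X \<longleftrightarrow> (\<forall>x\<in>mspace_of M. X x \<in> tangent_space M x)"

definition has_velocity ::
    "('p, 'e::banach) manifold \<Rightarrow> real set \<Rightarrow> (real \<Rightarrow> 'p) \<Rightarrow> real \<Rightarrow> ('p, 'e) tangent \<Rightarrow> bool"
  where "has_velocity M I u t v \<longleftrightarrow> v \<in> tangent_space M (u t) \<and>
     (\<forall>c\<in>charts_at M (u t). ((snd c \<circ> u) has_vector_derivative v c) (at t within I))"

text \<open>
  Continuity is required separately because \<open>snd c \<circ> u\<close> takes arbitrary values where \<open>u\<close> is
  outside the chart domain. The interval may be open, closed or half-open, with one-sided
  derivatives at end points, but it is not a single point.
\<close>

definition integral_curve ::
    "('p, 'e::banach) manifold \<Rightarrow> ('p \<Rightarrow> ('p, 'e) tangent) \<Rightarrow> real set \<Rightarrow> (real \<Rightarrow> 'p) \<Rightarrow> bool"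
  where "integral_curve M X I u \<longleftrightarrow> is_interval I \<and> 0 \<in> I \<and> I \<noteq> {0} \<and>
     continuous_map (top_of_set I) (mtop M) u \<and> (\<forall>t\<in>I. has_velocity M I u t (X (u t)))"

definition critical_point :: "('p, 'e::banach) manifold \<Rightarrow> ('p \<Rightarrow> real) \<Rightarrow> 'p \<Rightarrow> bool"
  where "critical_point M f x \<longleftrightarrow> x \<in> mspace_of M \<and>
     (\<forall>c\<in>charts_at M x. ((f \<circ> inv_into (fst c) (snd c)) has_derivative (\<lambda>_. 0)) (at (snd c x)))"

definition submersion ::
    "('p, 'e::banach) manifold \<Rightarrow> ('q, 'f::banach) manifold \<Rightarrow> ('p \<Rightarrow> 'q) \<Rightarrow> bool"
  where "submersion M N F \<longleftrightarrow> smooth_map M N F \<and>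
     (\<forall>x\<in>mspace_of M. \<forall>c\<in>charts_at M x. \<forall>d\<in>charts_at N (F x).
        let A = frechet_derivative (local_rep c d F) (at (snd c x)) in
        surj A \<and>
        (\<exists>K. subspace K \<and> closed K \<and> {v. A v = 0} \<inter> K = {0} \<and>
             (\<forall>v. \<exists>a k. A a = 0 \<and> k \<in> K \<and> v = a + k)))"

text \<open>
  Finite dimension is stated through a finite spanning set rather than through the class
  \<open>euclidean_space\<close>, whose members have positive dimension; zero-dimensional groups are allowed.
\<close>

definition lie_group :: "('g, 'b) monoid_scheme \<Rightarrow> ('g, 'l::banach) manifold \<Rightarrow> bool"
  where "lie_group G \<G> \<longleftrightarrow> group G \<and> banach_manifold \<G> \<and> mspace_of \<G> = carrier G \<and>
     (\<exists>B::'l set. finite B \<and> span B = UNIV) \<and>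
     smooth_map (prod_manifold \<G> \<G>) \<G> (\<lambda>(x, y). x \<otimes>\<^bsub>G\<^esub> y) \<and>
     smooth_map \<G> \<G> (\<lambda>x. inv\<^bsub>G\<^esub> x)"

definition one_parameter_subgroup ::
    "('g, 'b) monoid_scheme \<Rightarrow> ('g, 'l::banach) manifold \<Rightarrow> (real \<Rightarrow> 'g) \<Rightarrow> bool"
  where "one_parameter_subgroup G \<G> \<gamma> \<longleftrightarrow> smooth_map model_manifold \<G> \<gamma> \<and>
     (\<forall>s t. \<gamma> (s + t) = \<gamma> s \<otimes>\<^bsub>G\<^esub> \<gamma> t)"

definition lie_algebra :: "('g, 'b) monoid_scheme \<Rightarrow> ('g, 'l::banach) manifold \<Rightarrow> ('g, 'l) tangent set"
  where "lie_algebra G \<G> = tangent_space \<G> \<one>\<^bsub>G\<^esub>"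

definition lie_exp ::
    "('g, 'b) monoid_scheme \<Rightarrow> ('g, 'l::banach) manifold \<Rightarrow> ('g, 'l) tangent \<Rightarrow> 'g"
  where "lie_exp G \<G> \<xi> =
     (THE \<gamma>. one_parameter_subgroup G \<G> \<gamma> \<and> has_velocity \<G> UNIV \<gamma> 0 \<xi>) 1"

definition smooth_action :: "('g, 'b) monoid_scheme \<Rightarrow> ('g, 'l::banach) manifold \<Rightarrow>
    ('p, 'e::banach) manifold \<Rightarrow> ('g \<Rightarrow> 'p \<Rightarrow> 'p) \<Rightarrow> bool"
  where "smooth_action G \<G> M act \<longleftrightarrow> group_action G (mspace_of M) act \<and>
     smooth_map (prod_manifold \<G> M) M (\<lambda>(g, x). act g x)"

definition invariant_function ::
    "('g, 'b) monoid_scheme \<Rightarrow> ('p, 'e) manifold \<Rightarrow> ('g \<Rightarrow> 'p \<Rightarrow> 'p) \<Rightarrow> ('p \<Rightarrow> real) \<Rightarrow> bool"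
  where "invariant_function G M act f \<longleftrightarrow>
     (\<forall>g\<in>carrier G. \<forall>x\<in>mspace_of M. f (act g x) = f x)"

definition equivariant_field :: "('g, 'b) monoid_scheme \<Rightarrow> ('p, 'e::banach) manifold \<Rightarrow>
    ('g \<Rightarrow> 'p \<Rightarrow> 'p) \<Rightarrow> ('p \<Rightarrow> ('p, 'e) tangent) \<Rightarrow> bool"
  where "equivariant_field G M act X \<longleftrightarrow>
     (\<forall>g\<in>carrier G. \<forall>x\<in>mspace_of M. X (act g x) = tangent_map M M (act g) x (X x))"

definition relative_equilibrium :: "('g, 'b) monoid_scheme \<Rightarrow> ('g, 'l::banach) manifold \<Rightarrow>
    ('p, 'e::banach) manifold \<Rightarrow> ('g \<Rightarrow> 'p \<Rightarrow> 'p) \<Rightarrow> ('p \<Rightarrow> ('p, 'e) tangent) \<Rightarrow> 'p \<Rightarrow> bool"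
  where "relative_equilibrium G \<G> M act X m \<longleftrightarrow> m \<in> mspace_of M \<and>
     (\<exists>\<xi>\<in>lie_algebra G \<G>.
        integral_curve M X UNIV (\<lambda>t. act (lie_exp G \<G> (\<lambda>c. t *\<^sub>R \<xi> c)) m))"

definition linear_action :: "('g, 'b) monoid_scheme \<Rightarrow> ('g, 'l::banach) manifold \<Rightarrow> 'g set \<Rightarrow>
    ('g \<Rightarrow> 'v::banach \<Rightarrow> 'v) \<Rightarrow> bool"
  where "linear_action G \<G> H \<rho> \<longleftrightarrow>
     (\<forall>h\<in>H. bounded_linear (\<rho> h)) \<and> \<rho> \<one>\<^bsub>G\<^esub> = id \<and>
     (\<forall>h\<in>H. \<forall>k\<in>H. \<rho> (h \<otimes>\<^bsub>G\<^esub> k) = \<rho> h \<circ> \<rho> k) \<and>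
     continuous_map (prod_topology (subtopology (mtop \<G>) H) euclidean) euclidean (\<lambda>(h, v). \<rho> h v)"

text \<open>The orbit relation of the action \<open>h \<cdot> (g, s) = (g h\<^sup>-\<^sup>1, h s)\<close> of \<open>H\<close> on \<open>G \<times> S\<close>.\<close>

definition assoc_rel :: "('g, 'b) monoid_scheme \<Rightarrow> 'g set \<Rightarrow> ('g \<Rightarrow> 'v \<Rightarrow> 'v) \<Rightarrow> 'v set \<Rightarrow>
    (('g \<times> 'v) \<times> ('g \<times> 'v)) set"
  where "assoc_rel G H \<rho> S =
     {((g, s), (g \<otimes>\<^bsub>G\<^esub> inv\<^bsub>G\<^esub> h, \<rho> h s)) | g s h. g \<in> carrier G \<and> s \<in> S \<and> h \<in> H}"

definition assoc_class :: "('g, 'b) monoid_scheme \<Rightarrow> 'g set \<Rightarrow> ('g \<Rightarrow> 'v \<Rightarrow> 'v) \<Rightarrow> 'v set \<Rightarrow>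
    'g \<times> 'v \<Rightarrow> ('g \<times> 'v) set"
  where "assoc_class G H \<rho> S p = assoc_rel G H \<rho> S `` {p}"

text \<open>
  \<open>Q\<close> is the orbit space of \<open>G \<times> S\<close> with the quotient topology and with the smooth structure,
  unique if it exists, for which the projection is a submersion.
\<close>

definition associated_bundle :: "('g, 'b) monoid_scheme \<Rightarrow> ('g, 'l::banach) manifold \<Rightarrow> 'g set \<Rightarrow>
    ('g \<Rightarrow> 'v::banach \<Rightarrow> 'v) \<Rightarrow> 'v set \<Rightarrow> (('g \<times> 'v) set, 'q::banach) manifold \<Rightarrow> bool"
  where "associated_bundle G \<G> H \<rho> S Q \<longleftrightarrow>
     (let GS = prod_manifold \<G> (open_submanifold model_manifold S) in
      banach_manifold Q \<and>
      mspace_of Q = (carrier G \<times> S) // assoc_rel G H \<rho> S \<and>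
      quotient_map (mtop GS) (mtop Q) (assoc_class G H \<rho> S) \<and>
      submersion GS Q (assoc_class G H \<rho> S))"

definition slice_decomposition :: "('g, 'b) monoid_scheme \<Rightarrow> ('g, 'l::banach) manifold \<Rightarrow>
    ('p, 'e::banach) manifold \<Rightarrow> ('g \<Rightarrow> 'p \<Rightarrow> 'p) \<Rightarrow> 'p \<Rightarrow> ('g \<Rightarrow> 'v::banach \<Rightarrow> 'v) \<Rightarrow> 'v set \<Rightarrow>
    (('g \<times> 'v) set, 'q::banach) manifold \<Rightarrow> (('g \<times> 'v) set \<Rightarrow> 'p) \<Rightarrow> bool"
  where "slice_decomposition G \<G> M act m \<rho> S Q \<Psi> \<longleftrightarrow>
     (let H = stabilizer G act m; cls = assoc_class G H \<rho> S in
      linear_action G \<G> H \<rho> \<and>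
      (\<exists>r>0. S = ball 0 r) \<and> (\<forall>h\<in>H. \<rho> h ` S = S) \<and>
      associated_bundle G \<G> H \<rho> S Q \<and>
      (\<exists>N. openin (mtop M) N \<and> orbit G act m \<subseteq> N \<and> (\<forall>g\<in>carrier G. act g ` N = N) \<and>
           diffeomorphism Q (open_submanifold M N) \<Psi>) \<and>
      (\<forall>g\<in>carrier G. \<forall>k\<in>carrier G. \<forall>s\<in>S.
         \<Psi> (cls (g \<otimes>\<^bsub>G\<^esub> k, s)) = act g (\<Psi> (cls (k, s)))) \<and>
      \<Psi> (cls (\<one>\<^bsub>G\<^esub>, 0)) = m)"

definition slice_embedding :: "('g, 'b) monoid_scheme \<Rightarrow> ('g \<Rightarrow> 'p \<Rightarrow> 'p) \<Rightarrow> 'p \<Rightarrow>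
    ('g \<Rightarrow> 'v \<Rightarrow> 'v) \<Rightarrow> 'v set \<Rightarrow> (('g \<times> 'v) set \<Rightarrow> 'p) \<Rightarrow> 'v \<Rightarrow> 'p"
  where "slice_embedding G act m \<rho> S \<Psi> s =
     \<Psi> (assoc_class G (stabilizer G act m) \<rho> S (\<one>\<^bsub>G\<^esub>, s))"

end

theory Submission
  imports Defs
begin

text \<open>
  The obstacle that keeps a curve near the orbit is a sphere bundle. Write the points of the tube
  around \<open>G \<cdot> m\<close> as \<open>g \<cdot> s\<close> with \<open>s\<close> in the slice, and let \<open>a > 0\<close> be so small that \<open>P \<le> f\<close>
  on the closed slice ball of radius \<open>a\<close>. By invariance \<open>P \<le> f\<close> holds on the whole closed tube of
  radius \<open>a\<close>. On its boundary \<open>P\<close> is a positive constant \<open>\<delta>\<close>, because on the slice it is a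
  function of the norm alone; so no compactness of the sphere is needed. Hence a curve along which
  \<open>f < \<delta>\<close> never meets the boundary, and if it starts inside the tube it stays there, where
  \<open>P \<le> f\<close>.

  The stability hypothesis bounds \<open>f\<close> along curves that start near \<open>m\<close>. A curve that starts near
  another point of the orbit is moved near \<open>m\<close> by a group element; the translate is again an
  integral curve (\<open>integral_curve_translate\<close>), and \<open>f\<close> takes the same values along both.

  The topological points are that the open tube is open in \<open>M\<close> and the closed tube is closed in
  \<open>M\<close>. In the slice neighborhood both follow from the continuity of the norm of the slice
  coordinate (\<open>slice_decomposition_tubes\<close>). For closedness in \<open>M\<close> itself, where closed balls of the
  slice are not compact, regularity of \<open>M\<close> gives a closed neighborhood of \<open>m\<close> inside the slice
  neighborhood, and its translates by the compact group form a closed set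
  (\<open>closedin_compact_translates\<close>) that contains a thin enough tube. A connectedness argument then
  confines the curve (\<open>curve_stays_in_open\<close>).
\<close>

section \<open>Differentiability in charts\<close>

lemma smooth_on_imp_differentiable:
  assumes "smooth_on S f" "x \<in> S"
  shows "f differentiable (at x within S)"
proof -
  obtain D where D: "\<forall>x\<in>S. D [] x = f x \<and>
     (\<forall>us vs. linear (\<lambda>v. D (us @ v # vs) x)) \<and>
     (\<forall>n. \<exists>K. \<forall>vs. length vs = n \<longrightarrow> norm (D vs x) \<le> K * prod_list (map norm vs)) \<and>
     (\<forall>n. \<forall>e>0. \<exists>d>0. \<forall>y\<in>S. norm (y - x) < d \<longrightarrow> (\<forall>vs. length vs = n \<longrightarrow>
        norm (D vs y - D vs x - D ((y - x) # vs) x) \<le> e * norm (y - x) * prod_list (map norm vs)))"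
    using assms(1) unfolding smooth_on_def by (elim exE)
  then have D_nil: "\<And>y. y \<in> S \<Longrightarrow> D [] y = f y"
    by blast
  note Dx = bspec[OF D assms(2)]
  then have linear: "\<And>us vs. linear (\<lambda>v. D (us @ v # vs) x)"
    by (elim conjE) (erule allE, erule spec)
  obtain K where K: "\<forall>vs. length vs = 1 \<longrightarrow> norm (D vs x) \<le> K * prod_list (map norm vs)"
    using Dx by meson
  have remainder: "\<exists>d>0. \<forall>y\<in>S. norm (y - x) < d \<longrightarrow> (\<forall>vs. length vs = n \<longrightarrow>
      norm (D vs y - D vs x - D ((y - x) # vs) x) \<le> e * norm (y - x) * prod_list (map norm vs))"
    if "e > 0" for n e
    using Dx that by (elim conjE allE[of _ n] allE[of _ e]) (rule mp)
  have "bounded_linear (\<lambda>v. D [v] x)"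
  proof (rule bounded_linear.intro)
    show "linear (\<lambda>v. D [v] x)" using linear[of "[]" "[]"] by simp
    show "bounded_linear_axioms (\<lambda>v. D [v] x)"
      by standard (rule exI[of _ K], use K in \<open>auto simp: mult.commute dest: spec[of _ "[_]"]\<close>)
  qed
  moreover have "\<exists>d>0. \<forall>y\<in>S. norm (y - x) < d \<longrightarrow>
      norm (f y - f x - D [y - x] x) \<le> e * norm (y - x)" if "e > 0" for e
    using remainder[OF that, of 0] assms(2) by (simp add: D_nil)
  ultimately have "(f has_derivative (\<lambda>v. D [v] x)) (at x within S)"
    unfolding has_derivative_within_alt by blast
  then show ?thesis
    unfolding differentiable_def by blast
qed

lemma is_chart_inj_on:
  assumes "is_chart T c"
  shows "inj_on (snd c) (fst c)"
proof -
  have "topspace (subtopology T (fst c)) = fst c"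
    using assms openin_subset unfolding is_chart_def by (metis topspace_subtopology_subset)
  then show ?thesis
    using assms unfolding is_chart_def homeomorphic_map_def by simp
qed

lemma is_chart_open_image:
  assumes "is_chart T c" "openin T V" "V \<subseteq> fst c"
  shows "open (snd c ` V)"
proof -
  have "openin (subtopology T (fst c)) V"
    using assms openin_open_subtopology unfolding is_chart_def by blast
  then have "openin (top_of_set (snd c ` fst c)) (snd c ` V)"
    using assms(1) homeomorphic_map_openness_eq unfolding is_chart_def by blast
  then show ?thesis
    using assms(1) openin_open_trans unfolding is_chart_def by blast
qed

lemma local_rep_chart:
  assumes "is_chart T c" "x \<in> fst c"
  shows "local_rep c d F (snd c x) = snd d (F x)"
  using is_chart_inj_on[OF assms(1)] assms(2) unfolding local_rep_def by simp

lemma continuous_map_smooth_map_section: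
  assumes "smooth_map (prod_manifold A B) C F" "a \<in> mspace_of A"
  shows "continuous_map (mtop B) (mtop C) (\<lambda>y. F (a, y))"
proof -
  have "continuous_map (prod_topology (mtop A) (mtop B)) (mtop C) F"
    using assms(1) unfolding smooth_map_def prod_manifold_def by simp
  moreover have "continuous_map (mtop B) (prod_topology (mtop A) (mtop B)) (\<lambda>y. (a, y))"
    using assms(2) by (intro continuous_intros) auto
  ultimately show ?thesis
    using continuous_map_compose[of "mtop B" _ "\<lambda>y. (a, y)" "mtop C" F] by (simp add: o_def)
qed

text \<open>
  The chart expression of the section is the chart expression of \<open>F\<close> composed with the affine
  inclusion \<open>y \<mapsto> (\<phi> a, y)\<close>, where \<open>\<phi>\<close> is a chart at \<open>a\<close>.
\<close>

lemma smooth_map_section_differentiable: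
  fixes A :: "('a, 'd::banach) manifold" and B :: "('p, 'e::banach) manifold"
    and C :: "('q, 'f::banach) manifold"
  assumes A: "banach_manifold A" and B: "banach_manifold B"
    and C: "banach_manifold C"
    and F: "smooth_map (prod_manifold A B) C F" and a: "a \<in> mspace_of A"
    and c: "c \<in> charts_at B x" and d: "d \<in> charts_at C (F (a, x))"
  shows "local_rep c d (\<lambda>y. F (a, y)) differentiable (at (snd c x))"
proof -
  obtain b where b: "b \<in> charts A" "a \<in> fst b"
    using A a unfolding banach_manifold_def by blast
  have cd: "c \<in> charts B" "x \<in> fst c" "d \<in> charts C" "F (a, x) \<in> fst d"
    using c d unfolding charts_at_def by auto
  have bc: "is_chart (mtop A) b" and cc: "is_chart (mtop B) c"
    and dc: "is_chart (mtop C) d"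
    using A B C b cd unfolding banach_manifold_def by auto
  have inj: "inj_on (snd b) (fst b)" "inj_on (snd c) (fst c)"
    using is_chart_inj_on[OF bc] is_chart_inj_on[OF cc] by blast+
  define bxc where "bxc = (fst b \<times> fst c, map_prod (snd b) (snd c))"
  have "bxc = (\<lambda>((U, \<phi>), (V, \<psi>)). (U \<times> V, map_prod \<phi> \<psi>)) (b, c)"
    by (simp add: bxc_def case_prod_beta)
  then have "bxc \<in> charts (prod_manifold A B)"
    unfolding prod_manifold_def using b cd by auto
  then have smooth: "smooth_on (snd bxc ` (fst bxc \<inter> F -` fst d)) (local_rep bxc d F)"
    using F cd unfolding smooth_map_def by blast
  have cont: "continuous_map (prod_topology (mtop A) (mtop B)) (mtop C) F"
    using F unfolding smooth_map_def prod_manifold_def by simp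
  have rep: "local_rep bxc d F (snd b a', snd c y) = snd d (F (a', y))"
    if "a' \<in> fst b" "y \<in> fst c" for a' y
  proof -
    have "inj_on (map_prod (snd b) (snd c)) (fst b \<times> fst c)"
      using inj by (rule map_prod_inj_on)
    then have "inv_into (fst b \<times> fst c) (map_prod (snd b) (snd c))
        (map_prod (snd b) (snd c) (a', y)) = (a', y)"
      using that by (intro inv_into_f_f) auto
    then show ?thesis unfolding local_rep_def bxc_def by simp
  qed
  define V where "V = fst c \<inter> {y \<in> mspace_of B. F (a, y) \<in> fst d}"
  have "openin (mtop B) V"
    unfolding V_def using cc dc continuous_map_smooth_map_section[OF F a]
    by (intro openin_Int openin_continuous_map_preimage) (auto simp: is_chart_def)
  then have "open (snd c ` V)"
    by (rule is_chart_open_image[OF cc]) (simp add: V_def)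
  have "x \<in> mspace_of B"
    using cc cd(2) openin_subset unfolding is_chart_def by blast
  then have "x \<in> V"
    using cd by (simp add: V_def)
  let ?\<iota> = "\<lambda>y. (snd b a, y)"
  have "?\<iota> ` snd c ` V \<subseteq> snd bxc ` (fst bxc \<inter> F -` fst d)"
    using b(2) by (force simp: bxc_def V_def)
  moreover from this have "?\<iota> (snd c x) \<in> snd bxc ` (fst bxc \<inter> F -` fst d)"
    using \<open>x \<in> V\<close> by blast
  ultimately have "local_rep bxc d F differentiable (at (?\<iota> (snd c x)) within ?\<iota> ` snd c ` V)"
    using smooth_on_imp_differentiable[OF smooth] differentiable_within_subset by blast
  moreover have "?\<iota> differentiable (at (snd c x) within snd c ` V)"
    unfolding differentiable_def by (auto intro!: derivative_eq_intros)
  ultimately have "(local_rep bxc d F \<circ> ?\<iota>) differentiable (at (snd c x) within snd c ` V)"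
    by (rule differentiable_chain_within[rotated])
  then obtain L where
    L: "((local_rep bxc d F \<circ> ?\<iota>) has_derivative L) (at (snd c x))"
    using \<open>open (snd c ` V)\<close> \<open>x \<in> V\<close> at_within_open
    unfolding differentiable_def by (metis imageI)
  have "(local_rep bxc d F \<circ> ?\<iota>) z = local_rep c d (\<lambda>y. F (a, y)) z" if "z \<in> snd c ` V" for z
    using that rep b(2) local_rep_chart[OF cc, where d = d and F = "\<lambda>y. F (a, y)"]
    by (auto simp: V_def)
  then have "(local_rep c d (\<lambda>y. F (a, y)) has_derivative L) (at (snd c x))"
    using has_derivative_transform_within_open[OF L \<open>open (snd c ` V)\<close>] \<open>x \<in> V\<close> by blast
  then show ?thesis
    unfolding differentiable_def by blast
qed

section \<open>Images of integral curves\<close>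

text \<open>
  No regularity of the fields is needed: the chain rule along the curve uses only the
  differentiability of \<open>F\<close>.
\<close>

lemma integral_curve_image:
  fixes M :: "('p, 'e::banach) manifold" and N :: "('q, 'f::banach) manifold"
  assumes M: "banach_manifold M" and N: "banach_manifold N"
    and F: "continuous_map (mtop M) (mtop N) F"
    and diff: "\<And>x c d. \<lbrakk>c \<in> charts_at M x; d \<in> charts_at N (F x)\<rbrakk> \<Longrightarrow>
      local_rep c d F differentiable (at (snd c x))"
    and Y: "vector_field N Y"
    and related: "\<And>x. x \<in> mspace_of M \<Longrightarrow> Y (F x) = tangent_map M N F x (X x)"
    and u: "integral_curve M X I u"
  shows "integral_curve N Y I (F \<circ> u)"
proof -
  have cu: "continuous_map (top_of_set I) (mtop M) u"
    using u unfolding integral_curve_def by blast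
  have "has_velocity N I (F \<circ> u) t (Y (F (u t)))" if t: "t \<in> I" for t
  proof -
    have ut: "u t \<in> mspace_of M"
      using cu t by (metis continuous_map_image_subset_topspace image_subset_iff
          topspace_euclidean_subtopology)
    then have "F (u t) \<in> mspace_of N"
      using F continuous_map_image_subset_topspace by blast
    then have "Y (F (u t)) \<in> tangent_space N (F (u t))"
      using Y unfolding vector_field_def by blast
    moreover have "((snd d \<circ> (F \<circ> u)) has_vector_derivative Y (F (u t)) d) (at t within I)"
      if d: "d \<in> charts_at N (F (u t))" for d
    proof -
      define c where "c = (SOME c. c \<in> charts_at M (u t))"
      have "\<exists>c. c \<in> charts_at M (u t)"
        using M ut unfolding banach_manifold_def charts_at_def by blast
      then have c: "c \<in> charts_at M (u t)"
        unfolding c_def by (rule someI_ex)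
      then have cc: "is_chart (mtop M) c" and utc: "u t \<in> fst c"
        using M unfolding banach_manifold_def charts_at_def by auto
      have vel: "((snd c \<circ> u) has_vector_derivative X (u t) c) (at t within I)"
        using u t c unfolding integral_curve_def has_velocity_def by blast
      let ?L = "frechet_derivative (local_rep c d F) (at (snd c (u t)))"
      have "(local_rep c d F has_derivative ?L) (at ((snd c \<circ> u) t))"
        using diff[OF c d] by (simp flip: frechet_derivative_works)
      then have "(local_rep c d F has_derivative ?L)
          (at ((snd c \<circ> u) t) within (snd c \<circ> u) ` I)"
        by (rule has_derivative_at_withinI)
      from vector_derivative_diff_chain_within[OF vel this]
      have "((local_rep c d F \<circ> (snd c \<circ> u)) has_vector_derivative Y (F (u t)) d) (at t within I)"
        using related[OF ut] d by (simp add: tangent_map_def Let_def c_def o_def)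
      moreover
      \<comment> \<open>The chart expression and the curve agree only while \<open>u\<close> stays in the domain of \<open>c\<close>.\<close>
      have "openin (top_of_set I) {s \<in> I. u s \<in> fst c}"
        using openin_continuous_map_preimage[OF cu, of "fst c"] cc
        unfolding is_chart_def by simp
      then obtain J where J: "open J" "{s \<in> I. u s \<in> fst c} = I \<inter> J"
        unfolding openin_open by blast
      then have "t \<in> J" using t utc by blast
      then obtain e where e: "e > 0" "ball t e \<subseteq> J"
        using J(1) open_contains_ball by blast
      have "(local_rep c d F \<circ> (snd c \<circ> u)) s = (snd d \<circ> (F \<circ> u)) s"
        if "s \<in> I" "dist s t < e" for s
      proof -
        have "s \<in> J"
          using e(2) that(2) by (auto simp: dist_commute)
        then have "u s \<in> fst c"
          using J(2) that(1) by blast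
        then show ?thesis
          using local_rep_chart[OF cc] by simp
      qed
      ultimately show ?thesis
        using e(1) t has_vector_derivative_transform_within by blast
    qed
    ultimately show ?thesis
      unfolding has_velocity_def by simp
  qed
  moreover have "continuous_map (top_of_set I) (mtop N) (F \<circ> u)"
    using cu F by (rule continuous_map_compose)
  ultimately show ?thesis
    using u unfolding integral_curve_def by simp
qed

lemma integral_curve_translate:
  fixes \<G> :: "('g, 'l::banach) manifold" and M :: "('p, 'e::banach) manifold"
  assumes "banach_manifold M" "lie_group G \<G>" "smooth_action G \<G> M act"
    and "vector_field M X" "equivariant_field G M act X"
    and "integral_curve M X I u" "g \<in> carrier G"
  shows "integral_curve M X I (act g \<circ> u)"
proof -
  let ?F = "\<lambda>(g, x). act g x"
  have smooth: "smooth_map (prod_manifold \<G> M) M ?F"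
    using assms(3) unfolding smooth_action_def by blast
  have G: "banach_manifold \<G>" "g \<in> mspace_of \<G>"
    using assms(2,7) unfolding lie_group_def by auto
  show ?thesis
  proof (rule integral_curve_image)
    show "continuous_map (mtop M) (mtop M) (act g)"
      using continuous_map_smooth_map_section[OF smooth G(2)] by simp
    show "local_rep c d (act g) differentiable (at (snd c x))"
      if "c \<in> charts_at M x" "d \<in> charts_at M (act g x)" for x c d
      using smooth_map_section_differentiable[OF G(1) assms(1,1) smooth G(2) that(1), of d] that(2)
      by simp
    show "X (act g x) = tangent_map M M (act g) x (X x)" if "x \<in> mspace_of M" for x
      using assms(5,7) that unfolding equivariant_field_def by blast
  qed (use assms in auto)
qed


section \<open>Tubes around a group orbit\<close>

text \<open>
  The set is the image of the closed set \<open>{(g, x). g x \<in> C}\<close> under the projection along the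
  compact factor, which is a closed map.
\<close>

lemma closedin_compact_translates:
  assumes "compact_space K" "continuous_map (prod_topology K T) T (\<lambda>(g, x). act g x)"
    and "closedin T C"
  shows "closedin T {x \<in> topspace T. \<exists>g\<in>topspace K. act g x \<in> C}"
proof -
  let ?Z = "{p \<in> topspace (prod_topology K T). (\<lambda>(g, x). act g x) p \<in> C}"
  have "closedin (prod_topology K T) ?Z"
    using assms(2,3) by (rule closedin_continuous_map_preimage)
  then have "closedin T (snd ` ?Z)"
    using closed_map_snd[OF assms(1), of T] unfolding closed_map_def by blast
  moreover have "snd ` ?Z = {x \<in> topspace T. \<exists>g\<in>topspace K. act g x \<in> C}"
    by force
  ultimately show ?thesis by simp
qed

text \<open>
  The part of the tube around the orbit that is swept out by the points \<open>s\<close> of the slice with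
  \<open>norm s \<in> A\<close>; \<open>e\<close> embeds the slice into the manifold.
\<close>

definition slice_tube :: "('g, 'b) monoid_scheme \<Rightarrow> ('g \<Rightarrow> 'p \<Rightarrow> 'p) \<Rightarrow>
    ('v::real_normed_vector \<Rightarrow> 'p) \<Rightarrow> 'v set \<Rightarrow> real set \<Rightarrow> 'p set"
  where "slice_tube G act e S A = {act g (e s) | g s. g \<in> carrier G \<and> s \<in> S \<and> norm s \<in> A}"

lemma slice_tubeE:
  assumes "x \<in> slice_tube G act e S A"
  obtains g s where "g \<in> carrier G" "s \<in> S" "norm s \<in> A" "x = act g (e s)"
  using assms unfolding slice_tube_def by blast

text \<open>
  Two representatives of a class in the associated bundle differ by an element of \<open>H\<close>, which acts
  on the second component by an isometry.
\<close>

lemma assoc_class_eq_norm: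
  assumes "group G" "\<one>\<^bsub>G\<^esub> \<in> H" "\<rho> \<one>\<^bsub>G\<^esub> = id"
    and "\<forall>h\<in>H. \<forall>v. norm (\<rho> h v) = norm v"
    and "g \<in> carrier G" "s \<in> S"
    and "assoc_class G H \<rho> S (g, s) = assoc_class G H \<rho> S p"
  shows "norm s = norm (snd p)"
proof -
  interpret group G by fact
  have "((g, s), (g \<otimes>\<^bsub>G\<^esub> inv\<^bsub>G\<^esub> \<one>\<^bsub>G\<^esub>, \<rho> \<one>\<^bsub>G\<^esub> s)) \<in> assoc_rel G H \<rho> S"
    unfolding assoc_rel_def using assms(2,5,6) by blast
  then have "(g, s) \<in> assoc_class G H \<rho> S (g, s)"
    using assms(3,5) unfolding assoc_class_def by simp
  then have "(p, (g, s)) \<in> assoc_rel G H \<rho> S"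
    unfolding assms(7) by (simp add: assoc_class_def)
  then show ?thesis
    using assms(4) unfolding assoc_rel_def by auto
qed

text \<open>
  Because the isotropy subgroup preserves the norm, the norm of the slice coordinate is a
  well-defined continuous function on the slice neighborhood \<open>N\<close>. The statements about
  \<open>slice_tube\<close> for disjoint, open and closed sets of radii express this in terms of preimages.
\<close>

lemma slice_decomposition_tubes:
  fixes \<G> :: "('g, 'l::banach) manifold" and M :: "('p, 'e::banach) manifold"
    and \<rho> :: "'g \<Rightarrow> 'v::banach \<Rightarrow> 'v" and Q :: "(('g \<times> 'v) set, 'q::banach) manifold"
    and G :: "('g, 'b) monoid_scheme" and act m S \<Psi>
  defines "e \<equiv> slice_embedding G act m \<rho> S \<Psi>"
  assumes lie: "lie_group G \<G>" and act: "group_action G (mspace_of M) act"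
    and m: "m \<in> mspace_of M"
    and slice: "slice_decomposition G \<G> M act m \<rho> S Q \<Psi>"
    and norm_inv: "\<forall>h\<in>stabilizer G act m. \<forall>v. norm (\<rho> h v) = norm v"
  obtains N where "openin (mtop M) N" "orbit G act m \<subseteq> N" "\<And>g. g \<in> carrier G \<Longrightarrow> act g ` N = N"
    and "continuous_map (top_of_set S) (mtop M) e" "e 0 = m" "\<exists>r>0. S = ball 0 r"
    and "\<And>A. slice_tube G act e S A \<subseteq> N"
    and "\<And>A B. A \<inter> B = {} \<Longrightarrow> slice_tube G act e S A \<inter> slice_tube G act e S B = {}"
    and "\<And>A. open A \<Longrightarrow> openin (subtopology (mtop M) N) (slice_tube G act e S A)"
    and "\<And>A. closed A \<Longrightarrow> closedin (subtopology (mtop M) N) (slice_tube G act e S A)"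
proof -
  interpret group_action G "mspace_of M" act by (rule act)
  interpret group G using group_hom group_hom.axioms(1) by auto
  define H where "H = stabilizer G act m"
  define cls where "cls = assoc_class G H \<rho> S"
  obtain N where lin: "linear_action G \<G> H \<rho>" and ball: "\<exists>r>0. S = ball 0 r"
    and assoc: "associated_bundle G \<G> H \<rho> S Q"
    and N: "openin (mtop M) N" "orbit G act m \<subseteq> N" "\<forall>g\<in>carrier G. act g ` N = N"
    and diffeo: "diffeomorphism Q (open_submanifold M N) \<Psi>"
    and equivariant: "\<forall>g\<in>carrier G. \<forall>k\<in>carrier G. \<forall>s\<in>S.
         \<Psi> (cls (g \<otimes>\<^bsub>G\<^esub> k, s)) = act g (\<Psi> (cls (k, s)))"
    and base: "\<Psi> (cls (\<one>\<^bsub>G\<^esub>, 0)) = m"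
    using slice unfolding slice_decomposition_def Let_def H_def[symmetric] cls_def[symmetric]
    by blast
  have e: "e s = \<Psi> (cls (\<one>\<^bsub>G\<^esub>, s))" for s
    unfolding e_def slice_embedding_def cls_def H_def ..
  have NM: "topspace (subtopology (mtop M) N) = N"
    using N(1) openin_subset by (metis topspace_subtopology_subset)
  have \<Psi>: "bij_betw \<Psi> (mspace_of Q) N" "continuous_map (mtop Q) (subtopology (mtop M) N) \<Psi>"
      "continuous_map (subtopology (mtop M) N) (mtop Q) (inv_into (mspace_of Q) \<Psi>)"
    using diffeo NM unfolding diffeomorphism_def smooth_map_def open_submanifold_def by auto
  then have "homeomorphic_maps (mtop Q) (subtopology (mtop M) N) \<Psi> (inv_into (mspace_of Q) \<Psi>)"
    unfolding homeomorphic_maps_def NM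
    by (simp add: bij_betw_inv_into_left[OF \<Psi>(1)] bij_betw_inv_into_right[OF \<Psi>(1)])
  then have homeo: "homeomorphic_map (mtop Q) (subtopology (mtop M) N) \<Psi>"
    using homeomorphic_maps_map by blast
  define GS where "GS = prod_topology (mtop \<G>) (top_of_set S)"
  have GSeq: "mtop (prod_manifold \<G> (open_submanifold model_manifold S)) = GS"
    by (simp add: GS_def prod_manifold_def open_submanifold_def model_manifold_def)
  have quot: "quotient_map GS (mtop Q) cls"
    using assoc unfolding associated_bundle_def Let_def cls_def GSeq by blast
  have carrier: "mspace_of \<G> = carrier G"
    using lie unfolding lie_group_def by blast
  have GS: "topspace GS = carrier G \<times> S"
    unfolding GS_def by (simp add: carrier)
  have class_norm: "norm s = norm s'"
    if "g \<in> carrier G" "s \<in> S" "cls (g, s) = cls (g', s')" for g g' s s'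
  proof -
    have "\<one>\<^bsub>G\<^esub> \<in> H"
      unfolding H_def stabilizer_def using m by (simp flip: id_eq_one)
    moreover have "\<rho> \<one>\<^bsub>G\<^esub> = id"
      using lin unfolding linear_action_def by blast
    ultimately show ?thesis
      using assoc_class_eq_norm[OF is_group, of H \<rho> g s S "(g', s')"] norm_inv that
      unfolding H_def cls_def by simp
  qed
  define B where "B A = carrier G \<times> (S \<inter> norm -` A)" for A
  have B: "B A \<subseteq> topspace GS" for A
    unfolding B_def GS by blast
  have clsB: "cls ` B A \<subseteq> mspace_of Q" for A
    using B quotient_imp_surjective_map[OF quot] by blast
  \<comment> \<open>\<open>B A\<close> is saturated, so openness and closedness pass through the quotient map.\<close>
  have saturated: "{p \<in> topspace GS. cls p \<in> cls ` B A} = B A" for A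
    unfolding B_def GS by (auto dest: class_norm)
  have tube: "slice_tube G act e S A = \<Psi> ` cls ` B A" for A
  proof -
    have "\<Psi> (cls (g, s)) = act g (e s)" if "g \<in> carrier G" "s \<in> S" for g s
      using equivariant that unfolding e by (metis one_closed r_one)
    then show ?thesis
      unfolding slice_tube_def B_def by (force simp: image_iff)
  qed
  show ?thesis
  proof (rule that[OF N(1,2)])
    show "act g ` N = N" if "g \<in> carrier G" for g
      using N(3) that by blast
    show "continuous_map (top_of_set S) (mtop M) e"
    proof -
      have "continuous_map (top_of_set S) GS (\<lambda>s. (\<one>\<^bsub>G\<^esub>, s))"
        unfolding GS_def by (intro continuous_intros) (auto simp: carrier)
      then have "continuous_map (top_of_set S) (mtop M) (\<Psi> \<circ> (cls \<circ> (\<lambda>s. (\<one>\<^bsub>G\<^esub>, s))))"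
        using quotient_imp_continuous_map[OF quot] continuous_map_into_fulltopology[OF \<Psi>(2)]
        by (intro continuous_map_compose)
      then show ?thesis
        by (simp add: o_def flip: e)
    qed
    show "e 0 = m"
      using base by (simp add: e)
    show "\<exists>r>0. S = ball 0 r"
      by (rule ball)
    show "slice_tube G act e S A \<subseteq> N" for A
      unfolding tube using clsB \<Psi>(1) by (auto simp: bij_betw_def)
    show "slice_tube G act e S A \<inter> slice_tube G act e S A' = {}" if "A \<inter> A' = {}" for A A'
    proof -
      have "B A \<inter> B A' = {}"
        using that unfolding B_def by blast
      then have "cls ` B A \<inter> cls ` B A' = {}"
        using saturated B by blast
      then show ?thesis
        unfolding tube using clsB \<Psi>(1) inj_on_image_Int unfolding bij_betw_def
        by (metis image_empty)
    qed
    show "openin (subtopology (mtop M) N) (slice_tube G act e S A)" if "open A" for A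
    proof -
      have "openin (top_of_set S) (S \<inter> norm -` A)"
        by (rule continuous_openin_preimage_gen[OF continuous_on_norm_id that])
      then have "openin GS (B A)"
        unfolding GS_def B_def openin_prod_Times_iff
        using openin_topspace[of "mtop \<G>"] unfolding carrier by simp
      moreover have "openin GS {p \<in> topspace GS. cls p \<in> cls ` B A} \<longleftrightarrow>
          openin (mtop Q) (cls ` B A)"
        using quot clsB[of A] unfolding quotient_map_def by blast
      ultimately have "openin (mtop Q) (cls ` B A)"
        unfolding saturated by blast
      then show ?thesis
        unfolding tube using homeomorphic_map_openness[OF homeo clsB] by blast
    qed
    show "closedin (subtopology (mtop M) N) (slice_tube G act e S A)" if "closed A" for A
    proof -
      have "closedin (top_of_set S) (S \<inter> norm -` A)"
        by (rule continuous_closedin_preimage[OF continuous_on_norm_id that])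
      then have "closedin GS (B A)"
        unfolding GS_def B_def closedin_prod_Times_iff
        using closedin_topspace[of "mtop \<G>"] unfolding carrier by simp
      moreover have "closedin GS {p \<in> topspace GS. cls p \<in> cls ` B A} \<longleftrightarrow>
          closedin (mtop Q) (cls ` B A)"
        using quot clsB[of A] unfolding quotient_map_closedin by blast
      ultimately have "closedin (mtop Q) (cls ` B A)"
        unfolding saturated by blast
      then show ?thesis
        unfolding tube using homeomorphic_map_closedness[OF homeo clsB] by blast
    qed
  qed
qed


section \<open>Confinement of curves\<close>

lemma regular_space_closed_neighbourhood:
  assumes "regular_space T" "openin T N" "x \<in> N"
  obtains U C where "openin T U" "closedin T C" "x \<in> U" "U \<subseteq> C" "C \<subseteq> N"
proof -
  have "closedin T (topspace T - N)" "x \<in> topspace T - (topspace T - N)"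
    using assms(2,3) openin_subset by blast+
  then obtain U V where UV: "openin T U" "openin T V" "x \<in> U" "topspace T - N \<subseteq> V" "disjnt U V"
    using assms(1) unfolding regular_space_def by meson
  show ?thesis
  proof (rule that[OF UV(1) _ UV(3)])
    show "closedin T (topspace T - V)"
      using UV(2) by blast
    show "U \<subseteq> topspace T - V" "topspace T - V \<subseteq> N"
      using UV openin_subset unfolding disjnt_def by blast+
  qed
qed

text \<open>
  If \<open>u\<close> never meets \<open>B - A\<close> at nonnegative times, then the open sets \<open>A\<close> and \<open>- B\<close> cover the
  connected image of the nonnegative part of \<open>I\<close>.
\<close>

lemma curve_stays_in_open:
  assumes u: "continuous_map (top_of_set I) T u" and I: "is_interval I" "0 \<in> I"
    and A: "openin T A" and B: "closedin T B" and "A \<subseteq> B"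
    and barrier: "\<And>t. \<lbrakk>t \<in> I; 0 \<le> t; u t \<in> B\<rbrakk> \<Longrightarrow> u t \<in> A"
    and "u (0::real) \<in> A" "t \<in> I" "0 \<le> t"
  shows "u t \<in> A"
proof (rule ccontr)
  assume "u t \<notin> A"
  then have t: "u t \<notin> B"
    using barrier assms(9,10) by blast
  let ?J = "I \<inter> {0..}"
  have "continuous_map (top_of_set ?J) T u"
    using continuous_map_from_subtopology[OF u, of ?J]
    by (simp add: subtopology_subtopology Int_absorb1 inf_assoc[symmetric])
  moreover have "connected ?J"
    using I(1) by (intro is_interval_connected is_interval_Int is_interval_ci)
  then have "connectedin (top_of_set ?J) ?J"
    by (simp add: connectedin_subtopology)
  ultimately have "connectedin T (u ` ?J)"
    by (rule connectedin_continuous_map_image)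
  moreover have "openin T (topspace T - B)"
    using B by blast
  moreover have "u ` ?J \<subseteq> topspace T"
    using calculation(1) connectedin_subset_topspace by blast
  then have "u ` ?J \<subseteq> A \<union> (topspace T - B)"
    using barrier by auto
  moreover have "A \<inter> (topspace T - B) \<inter> u ` ?J = {}"
    using \<open>A \<subseteq> B\<close> by blast
  moreover have "A \<inter> u ` ?J \<noteq> {}"
    using assms(2,3,8) by force
  moreover have "(topspace T - B) \<inter> u ` ?J \<noteq> {}"
    using t assms(9,10) \<open>u ` ?J \<subseteq> topspace T\<close> by force
  ultimately show False
    using A unfolding connectedin by blast
qed

section \<open>Stability of relative equilibria\<close>

theorem theorem3:
  fixes G :: "('g, 'b) monoid_scheme"
    and \<G> :: "('g, 'l::banach) manifold"
    and M :: "('p, 'e::banach) manifold"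
    and act :: "'g \<Rightarrow> 'p \<Rightarrow> 'p"
    and X :: "'p \<Rightarrow> ('p, 'e) tangent"
    and m :: 'p
    and \<rho> :: "'g \<Rightarrow> 'v::banach \<Rightarrow> 'v"
    and S :: "'v set"
    and Q :: "(('g \<times> 'v) set, 'q::banach) manifold"
    and \<Psi> :: "('g \<times> 'v) set \<Rightarrow> 'p"
    and P f :: "'p \<Rightarrow> real"
  assumes "banach_manifold M"
    and "lie_group G \<G>" and "compact_space (mtop \<G>)"
    and "smooth_action G \<G> M act"
    and "vector_field M X" and "equivariant_field G M act X"
    and "relative_equilibrium G \<G> M act X m"
    and "slice_decomposition G \<G> M act m \<rho> S Q \<Psi>"
    and norm_invariant: "\<forall>h\<in>stabilizer G act m. \<forall>v. norm (\<rho> h v) = norm v"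
    and "continuous_map (mtop M) euclideanreal P" and "invariant_function G M act P"
    and P_norm: "\<exists>p. \<forall>s\<in>S. P (slice_embedding G act m \<rho> S \<Psi> s) = p (norm s)"
    and P_zero: "P (slice_embedding G act m \<rho> S \<Psi> 0) = 0"
    and P_strict_min: "\<forall>s\<in>S. s \<noteq> 0 \<longrightarrow> 0 < P (slice_embedding G act m \<rho> S \<Psi> s)"
    and "invariant_function G M act f" and "f m = 0"
    and critical: "critical_point M f m"
    and P_le_f: "\<exists>W. openin (mtop M) W \<and> m \<in> W \<and> (\<forall>x\<in>W. P x \<le> f x)"
    and f_stable: "\<forall>\<epsilon>>0. \<exists>V. openin (mtop M) V \<and> m \<in> V \<and>
      (\<forall>I u. integral_curve M X I u \<and> u 0 \<in> V \<longrightarrow> (\<forall>t\<in>I. 0 \<le> t \<longrightarrow> f (u t) < \<epsilon>))"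
  shows "\<forall>\<epsilon>>0. \<exists>U. openin (mtop M) U \<and> orbit G act m \<subseteq> U \<and>
      (\<forall>I u. integral_curve M X I u \<and> u 0 \<in> U \<longrightarrow> (\<forall>t\<in>I. 0 \<le> t \<longrightarrow> P (u t) < \<epsilon>))"
proof (intro allI impI)
  fix \<epsilon> :: real assume "0 < \<epsilon>"
  define e where "e = slice_embedding G act m \<rho> S \<Psi>"
  define Tube where "Tube = slice_tube G act e S"
  have cont_act: "continuous_map (prod_topology (mtop \<G>) (mtop M)) (mtop M) (\<lambda>(g, x). act g x)"
    and ga: "group_action G (mspace_of M) act"
    using assms(4) unfolding smooth_action_def smooth_map_def prod_manifold_def by auto
  interpret group_action G "mspace_of M" act by (rule ga)
  interpret group G using group_hom group_hom.axioms(1) by auto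
  have carrier: "mspace_of \<G> = carrier G"
    using assms(2) unfolding lie_group_def by blast
  have m: "m \<in> mspace_of M"
    using critical unfolding critical_point_def by blast
  obtain N where N: "openin (mtop M) N" "orbit G act m \<subseteq> N" "\<And>g. g \<in> carrier G \<Longrightarrow> act g ` N = N"
    and e: "continuous_map (top_of_set S) (mtop M) e" "e 0 = m" "\<exists>r>0. S = ball 0 r"
    and Tube_N: "\<And>A. Tube A \<subseteq> N"
    and Tube_disjoint: "\<And>A B. A \<inter> B = {} \<Longrightarrow> Tube A \<inter> Tube B = {}"
    and Tube_open: "\<And>A. open A \<Longrightarrow> openin (subtopology (mtop M) N) (Tube A)"
    and Tube_closed: "\<And>A. closed A \<Longrightarrow> closedin (subtopology (mtop M) N) (Tube A)"
    using slice_decomposition_tubes[OF assms(2) ga m assms(8) norm_invariant]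
    unfolding e_def Tube_def by metis
  have S: "open S" "0 \<in> S"
    using e(3) by auto
  have eM: "e s \<in> mspace_of M" if "s \<in> S" for s
    using continuous_map_image_subset_topspace[OF e(1)] that by auto
  obtain W where W: "openin (mtop M) W" "m \<in> W" "\<And>x. x \<in> W \<Longrightarrow> P x \<le> f x"
    using P_le_f by blast
  have "m \<in> N"
    using N(2) orbit_refl[OF m] by blast
  then obtain D C where DC: "openin (mtop M) D" "closedin (mtop M) C" "m \<in> D" "D \<subseteq> C" "C \<subseteq> N"
    using assms(1) N(1) regular_space_closed_neighbourhood unfolding banach_manifold_def by metis

  \<comment> \<open>A radius for which the closed slice ball lies where \<open>P \<le> f\<close> holds and away from the
    boundary of the slice neighborhood.\<close>
  obtain a where a: "a > 0" "cball 0 a \<subseteq> S" "\<And>s. s \<in> cball 0 a \<Longrightarrow> e s \<in> D \<inter> W"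
  proof -
    define R where "R = {s \<in> S. e s \<in> D \<inter> W}"
    have "openin (top_of_set S) R"
      unfolding R_def
      using openin_continuous_map_preimage[OF e(1) openin_Int[OF DC(1) W(1)]] by simp
    then have "open R"
      using openin_open_trans[OF _ S(1)] by blast
    moreover have "0 \<in> R"
      unfolding R_def using e(2) S(2) DC(3) W(2) by simp
    ultimately obtain a where "a > 0" "cball 0 a \<subseteq> R"
      unfolding open_contains_cball by blast
    then show ?thesis
      unfolding R_def
      by (intro that) auto
  qed

  have inner_open: "openin (mtop M) (Tube {..<a})"
    by (rule openin_trans_full[OF Tube_open[OF open_lessThan] N(1)])
  have outer_closed: "closedin (mtop M) (Tube {..a})"
  proof -
    define K where "K = {x \<in> mspace_of M. \<exists>g\<in>carrier G. act g x \<in> C}"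
    have K: "closedin (mtop M) K"
      using closedin_compact_translates[OF assms(3) cont_act DC(2)] unfolding K_def carrier .
    have "K \<subseteq> N"
    proof
      fix x assume "x \<in> K"
      then obtain g where g: "g \<in> carrier G" "x \<in> mspace_of M" "act g x \<in> N"
        unfolding K_def using DC(5) by blast
      then have "act (inv\<^bsub>G\<^esub> g) (act g x) \<in> N"
        using N(3)[of "inv\<^bsub>G\<^esub> g"] by blast
      then show "x \<in> N"
        using orbit_sym_aux[OF g(1,2)] by simp
    qed
    moreover have "Tube {..a} \<subseteq> K"
    proof
      fix x assume "x \<in> Tube {..a}"
      then obtain g s where gs: "g \<in> carrier G" "s \<in> S" "norm s \<in> {..a}" "x = act g (e s)"
        unfolding Tube_def by (rule slice_tubeE)
      then have "act (inv\<^bsub>G\<^esub> g) x \<in> C"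
        using orbit_sym_aux[OF gs(1) eM[OF gs(2)]] a(3)[of s] DC(4) by auto
      moreover have "x \<in> mspace_of M"
        using element_image[OF gs(1) eM[OF gs(2)]] gs(4) by simp
      ultimately show "x \<in> K"
        unfolding K_def using gs(1) by blast
    qed
    moreover obtain T where T: "closedin (mtop M) T" "Tube {..a} = T \<inter> N"
      using Tube_closed[of "{..a}"] unfolding closedin_subtopology by auto
    ultimately have "Tube {..a} = T \<inter> K"
      by blast
    then show ?thesis
      using T(1) K by (simp add: closedin_Int)
  qed

  have P_orbit: "P (act g (e s)) = P (e s)" and f_orbit: "f (act g (e s)) = f (e s)"
    if "g \<in> carrier G" "s \<in> S" for g s
    using assms(11,15) that eM unfolding invariant_function_def by blast+
  have P_le_f_tube: "P x \<le> f x" if x: "x \<in> Tube {..a}" for x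
  proof -
    obtain g s where gs: "g \<in> carrier G" "s \<in> S" "norm s \<in> {..a}" "x = act g (e s)"
      using x unfolding Tube_def by (rule slice_tubeE)
    then have "P (e s) \<le> f (e s)"
      using a(3)[of s] W(3) by auto
    then show ?thesis
      using P_orbit f_orbit gs by simp
  qed
  obtain \<delta> where \<delta>: "\<delta> > 0" "\<And>x. x \<in> Tube {..a} \<Longrightarrow> x \<notin> Tube {..<a} \<Longrightarrow> \<delta> \<le> P x"
  proof -
    obtain p where p: "\<And>s. s \<in> S \<Longrightarrow> P (e s) = p (norm s)"
      using P_norm unfolding e_def by blast
    \<comment> \<open>If the slice representation is the zero space, then there is no vector of norm \<open>a\<close> and
      \<open>p a\<close> is arbitrary.\<close>
    define \<delta> where "\<delta> = (if \<exists>s\<in>S. norm s = a then p a else 1)"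
    have "\<delta> > 0"
    proof (cases "\<exists>s\<in>S. norm s = a")
      case True
      then obtain s where s: "s \<in> S" "norm s = a" by blast
      then have "0 < P (e s)"
        using P_strict_min a(1) unfolding e_def by auto
      then show ?thesis
        using p s True unfolding \<delta>_def by auto
    qed (simp add: \<delta>_def)
    moreover have "\<delta> \<le> P x" if x: "x \<in> Tube {..a}" "x \<notin> Tube {..<a}" for x
    proof -
      obtain g s where gs: "g \<in> carrier G" "s \<in> S" "norm s \<in> {..a}" "x = act g (e s)"
        using x(1) unfolding Tube_def by (rule slice_tubeE)
      have "norm s \<notin> {..<a}"
        using x(2) gs unfolding Tube_def slice_tube_def by blast
      then have "norm s = a"
        using gs(3) by simp
      then have "\<delta> = P (e s)"
        using p gs(2) unfolding \<delta>_def by auto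
      then show ?thesis
        using P_orbit gs by simp
    qed
    ultimately show ?thesis by (rule that)
  qed

  obtain V where V: "openin (mtop M) V" "m \<in> V"
    "\<And>I u t. \<lbrakk>integral_curve M X I u; u 0 \<in> V; t \<in> I; 0 \<le> t\<rbrakk> \<Longrightarrow> f (u t) < min \<epsilon> \<delta>"
    using f_stable \<open>0 < \<epsilon>\<close> \<delta>(1) by (metis min_less_iff_conj)
  \<comment> \<open>Only starting points with a translate in \<open>V\<close> are admitted.\<close>
  define U where "U = Tube {..<a} \<inter> (\<Union>g\<in>carrier G. {x \<in> mspace_of M. act g x \<in> V})"
  have "openin (mtop M) {x \<in> mspace_of M. act g x \<in> V}" if "g \<in> carrier G" for g
    using openin_continuous_map_preimage[OF _ V(1), of "mtop M" "act g"] that carrier assms(4)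
      continuous_map_smooth_map_section[of \<G> M M "\<lambda>(g, x). act g x" g]
    unfolding smooth_action_def by simp
  then have U_open: "openin (mtop M) U"
    unfolding U_def using inner_open by blast
  have U_orbit: "orbit G act m \<subseteq> U"
  proof
    fix x assume "x \<in> orbit G act m"
    then obtain g where g: "g \<in> carrier G" "x = act g m"
      unfolding orbit_def by blast
    have "x \<in> Tube {..<a}"
      unfolding Tube_def slice_tube_def using g a(1,2) e(2) by force
    moreover have "act (inv\<^bsub>G\<^esub> g) x \<in> V"
      using orbit_sym_aux[OF g(1) m] g(2) V(2) by simp
    moreover have "x \<in> mspace_of M"
      using element_image[OF g(1) m] g(2) by simp
    ultimately show "x \<in> U"
      unfolding U_def using g(1) by blast
  qed
  have stable: "P (u t) < \<epsilon>" if u: "integral_curve M X I u" and u0: "u 0 \<in> U"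
    and t: "t \<in> I" "0 \<le> t" for I u t
  proof -
    obtain g where g: "g \<in> carrier G" "act g (u 0) \<in> V"
      using u0 unfolding U_def by blast
    have cu: "continuous_map (top_of_set I) (mtop M) u" and I: "is_interval I" "0 \<in> I"
      using u unfolding integral_curve_def by auto
    have f_small: "f (u s) < min \<epsilon> \<delta>" if s: "s \<in> I" "0 \<le> s" for s
    proof -
      have "integral_curve M X I (act g \<circ> u)"
        using integral_curve_translate[OF assms(1,2,4-6) u g(1)] .
      then have "f (act g (u s)) < min \<epsilon> \<delta>"
        using V(3)[of I "act g \<circ> u" s] g(2) s by simp
      moreover have "u s \<in> mspace_of M"
        using continuous_map_image_subset_topspace[OF cu] s(1) by auto
      ultimately show ?thesis
        using assms(15) g(1) unfolding invariant_function_def by simp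
    qed
    have sub: "Tube {..<a} \<subseteq> Tube {..a}"
      unfolding Tube_def slice_tube_def by fastforce
    have "u t \<in> Tube {..<a}"
    proof (rule curve_stays_in_open[OF cu I inner_open outer_closed sub _ _ t])
      show "u 0 \<in> Tube {..<a}"
        using u0 unfolding U_def by blast
      show "u s \<in> Tube {..<a}" if "s \<in> I" "0 \<le> s" "u s \<in> Tube {..a}" for s
        using f_small[OF that(1,2)] P_le_f_tube[OF that(3)] \<delta>(2)[OF that(3)] by linarith
    qed
    then show ?thesis
      using P_le_f_tube f_small[OF t] sub by fastforce
  qed
  show "\<exists>U. openin (mtop M) U \<and> orbit G act m \<subseteq> U \<and>
      (\<forall>I u. integral_curve M X I u \<and> u 0 \<in> U \<longrightarrow> (\<forall>t\<in>I. 0 \<le> t \<longrightarrow> P (u t) < \<epsilon>))"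
    using U_open U_orbit stable by blast
qed

end
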